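(* Let $m$ be an integer with $1\leq m\leq 5$, let $b$ be an odd positive integer, and let $a\ge 0$ and $k$ be integers. If $(k,4m,2^ab,2,2)$ is admissible and $$(k,4m,2^ab,2,2)\notin\{(3,4c,4,2,2),(3,4,4c,2,2)\mid c \text{ is odd}\},$$ then there exists an array of type $I_k(4m,2^ab,2,2)$.
   Context: For an integer $s\ge 1$ let $[s]=\{0,1,\dots,s-1\}$. An orthogonal array OA$(n,k,q,t)$ (size $n$, degree $k$, $q$ levels, strength $t$, $1\le t\leq k$) is an $n\times k$ array with entries from $[q]$ such that in every $n\times t$ submatrix (choice of $t$ columns), every vector of $[q]^t$ appears as a row exactly $n/q^t$ times. An array of type $I_k(m,n,q,t)$ (an $m\times n$ row-column factorial design $q^k$ of strength $t$) is an $m\times n$ array whose cells each contain a vector of $[q]^k$ such that: (i) each vector of $[q]^k$ occurs in exactly $\lambda=mn/q^k$ cells (so $q^k\mid mn$); (ii) for each row of the array, the $n$ vectors in that row are the rows of an OA$(n,k,q,t)$; (iii) for each column of the array, the $m$ vectors in that column are the rows of an OA$(m,k,q,t)$. A 5-tuple $(k,m,n,q,t)$ is admissible if $q^k\mid mn$, there exists an OA$(m,k,q,t)$, and there exists an OA$(n,k,q,t)$. *)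

theory Defs
  imports Main "HOL-Library.FuncSet"
begin

text \<open>
  The level set \<open>[q] = {0, ..., q - 1}\<close> is \<open>{..<q}\<close>. A vector over \<open>[q]\<close> with coordinates
  indexed by a finite set \<open>S\<close> is an extensional function in \<open>S \<rightarrow>\<^sub>E {..<q}\<close>, so that equality
  of vectors is equality of functions; \<open>[q]^k\<close> is the case \<open>S = {..<k}\<close>.
\<close>

definition level_vectors :: "nat \<Rightarrow> nat \<Rightarrow> (nat \<Rightarrow> nat) set" where
  "level_vectors q k = ({..<k} \<rightarrow>\<^sub>E {..<q})"

text \<open>
  \<open>A i\<close> is row \<open>i\<close> of the array, for \<open>i < n\<close> (values at \<open>i \<ge> n\<close> are irrelevant). A choice of \<open>t\<close>
  columns is a \<open>t\<close>-subset \<open>S\<close> of the column indices. That a vector occurs exactly \<open>n / q^t\<close>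
  times is written multiplicatively, so it includes the divisibility of \<open>n\<close> by \<open>q^t\<close>.
\<close>

definition orthogonal_array ::
  "nat \<Rightarrow> nat \<Rightarrow> nat \<Rightarrow> nat \<Rightarrow> (nat \<Rightarrow> nat \<Rightarrow> nat) \<Rightarrow> bool" where
  "orthogonal_array n k q t A \<longleftrightarrow>
     1 \<le> q \<and> 1 \<le> t \<and> t \<le> k \<and>
     (\<forall>i<n. A i \<in> level_vectors q k) \<and>
     (\<forall>S. S \<subseteq> {..<k} \<and> card S = t \<longrightarrow>
        (\<forall>v \<in> S \<rightarrow>\<^sub>E {..<q}. card {i. i < n \<and> restrict (A i) S = v} * q ^ t = n))"

text \<open>\<open>F i j\<close> is the vector in the cell in row \<open>i < m\<close> and column \<open>j < n\<close>.\<close>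

definition factorial_design ::
  "nat \<Rightarrow> nat \<Rightarrow> nat \<Rightarrow> nat \<Rightarrow> nat \<Rightarrow> (nat \<Rightarrow> nat \<Rightarrow> nat \<Rightarrow> nat) \<Rightarrow> bool" where
  "factorial_design k m n q t F \<longleftrightarrow>
     (\<forall>i<m. \<forall>j<n. F i j \<in> level_vectors q k) \<and>
     (\<forall>v \<in> level_vectors q k. card {(i, j). i < m \<and> j < n \<and> F i j = v} * q ^ k = m * n) \<and>
     (\<forall>i<m. orthogonal_array n k q t (\<lambda>j. F i j)) \<and>
     (\<forall>j<n. orthogonal_array m k q t (\<lambda>i. F i j))"

definition admissible :: "nat \<times> nat \<times> nat \<times> nat \<times> nat \<Rightarrow> bool" where
  "admissible = (\<lambda>(k, m, n, q, t).
     q ^ k dvd m * n \<and>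
     (\<exists>A. orthogonal_array m k q t A) \<and>
     (\<exists>A. orthogonal_array n k q t A))"

end

(*
  Entries are encoded by signs, so that an array has strength 2 iff every column and every
  product of two distinct columns sums to 0. Squaring the inner products of one row with all the
  rows then gives Rao's bound k + 1 <= n, and q^k | mn bounds k by the 2-adic valuation of mn.

  Call a design with k factors extended if its columns are orthogonal arrays with K >= k factors.
  Placing it next to a copy in which factor k is flipped yields an extended design with k + 1
  factors on twice as many columns, as long as k < K; placing designs with the same k side by
  side adds the numbers of columns. All admissible parameters follow in this way from six designs.
  Five of them, of sizes 4 x 4, 8 x 8, 16 x 16, 12 x 8 and 20 x 8, have K as large as possible:
  each column is a permuted translate of the rows of a normalized Hadamard matrix. The sixth is
  an I_4(12,12,2,2).
*)
theory Submission
  imports Defs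
begin

section \<open>Boolean arrays of strength 2\<close>

definition sign :: "bool \<Rightarrow> int" where
  "sign x = (if x then - 1 else 1)"

lemma sign_mult_self [simp]: "sign x * sign x = 1"
  by (simp add: sign_def)

lemma sign_not [simp]: "sign (\<not> x) = - sign x"
  by (simp add: sign_def)

text \<open>Exclusive or becomes multiplication. The statement has the form to which the simplifier
  brings \<open>x \<noteq> y\<close> on Booleans.\<close>

lemma sign_eq_not: "sign (x = (\<not> y)) = sign x * sign y"
  by (simp add: sign_def)

definition strength2 :: "nat \<Rightarrow> nat \<Rightarrow> (nat \<Rightarrow> nat \<Rightarrow> bool) \<Rightarrow> bool" where
  "strength2 n k A \<longleftrightarrow>
     (\<forall>p<k. (\<Sum>i<n. sign (A i p)) = 0) \<and>
     (\<forall>p<k. \<forall>r<k. p \<noteq> r \<longrightarrow> (\<Sum>i<n. sign (A i p) * sign (A i r)) = 0)"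

text \<open>An indicator sum instead of a cardinality, so that splitting the columns and
  interchanging rows with columns are identities of sums.\<close>

definition occurrences ::
  "nat \<Rightarrow> nat \<Rightarrow> nat \<Rightarrow> (nat \<Rightarrow> nat \<Rightarrow> nat \<Rightarrow> bool) \<Rightarrow> (nat \<Rightarrow> bool) \<Rightarrow> nat" where
  "occurrences k m n F v = (\<Sum>i<m. \<Sum>j<n. of_bool (\<forall>c<k. F i j c = v c))"

text \<open>
  Only the first \<open>k\<close> coordinates form the design; the coordinates from \<open>k\<close> up to \<open>K\<close> are
  constrained within the columns alone.
\<close>

definition extended_design ::
  "nat \<Rightarrow> nat \<Rightarrow> nat \<Rightarrow> nat \<Rightarrow> (nat \<Rightarrow> nat \<Rightarrow> nat \<Rightarrow> bool) \<Rightarrow> bool" where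
  "extended_design K k m n F \<longleftrightarrow>
     k \<le> K \<and> (\<forall>j<n. strength2 m K (\<lambda>i. F i j)) \<and> (\<forall>i<m. strength2 n k (F i)) \<and>
     (\<forall>v. 2 ^ k * occurrences k m n F v = m * n)"

lemma sum_lessThan_add:
  fixes f :: "nat \<Rightarrow> 'a::comm_monoid_add"
  shows "(\<Sum>i<a + b. f i) = (\<Sum>i<a. f i) + (\<Sum>i<b. f (a + i))"
  by (induction b) (simp_all add: add.assoc)

lemma strength2_mono:
  assumes "strength2 n k A" "l \<le> k"
  shows "strength2 n l A"
  using assms by (auto simp: strength2_def)

lemma strength2_append:
  assumes "strength2 m k A" "strength2 n k B"
  shows "strength2 (m + n) k (\<lambda>i. if i < m then A i else B (i - m))"
  using assms by (simp add: strength2_def sum_lessThan_add)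

text \<open>\<open>w\<close> is added modulo 2, which multiplies each of the sums by a sign that
  does not depend on the row.\<close>

lemma strength2_translate:
  assumes "strength2 n k A"
  shows "strength2 n k (\<lambda>i c. A i c \<noteq> w c)"
proof -
  have "(\<Sum>i<n. sign (A i p \<noteq> w p)) = sign (w p) * (\<Sum>i<n. sign (A i p))" for p
    by (simp add: sign_eq_not sum_distrib_left mult.commute)
  moreover have "(\<Sum>i<n. sign (A i p \<noteq> w p) * sign (A i r \<noteq> w r)) =
      sign (w p) * sign (w r) * (\<Sum>i<n. sign (A i p) * sign (A i r))" for p r
    by (simp add: sign_eq_not sum_distrib_left algebra_simps)
  ultimately show ?thesis
    using assms by (simp add: strength2_def)
qed

lemma strength2_permute:
  assumes "strength2 n k A" "bij_betw f {..<n} {..<n}"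
  shows "strength2 n k (\<lambda>i. A (f i))"
proof -
  have "(\<Sum>i<n. g (f i)) = (\<Sum>i<n. g i)" for g :: "nat \<Rightarrow> int"
    using sum.reindex_bij_betw[OF assms(2)] .
  from this[of "\<lambda>i. sign (A i _)"] this[of "\<lambda>i. sign (A i _) * sign (A i _)"]
  show ?thesis
    using assms(1) by (simp add: strength2_def)
qed

section \<open>Dropping factors, transposing, juxtaposing and doubling\<close>

lemma occurrences_Suc:
  "occurrences k m n F v =
     occurrences (Suc k) m n F (v(k := True)) + occurrences (Suc k) m n F (v(k := False))"
proof -
  have "of_bool (\<forall>c<k. F i j c = v c) =
      (of_bool (\<forall>c<Suc k. F i j c = (v(k := True)) c) +
       of_bool (\<forall>c<Suc k. F i j c = (v(k := False)) c) :: nat)" for i j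
    by (auto simp: less_Suc_eq)
  then show ?thesis
    by (simp add: occurrences_def sum.distrib)
qed

text \<open>A vector on \<open>k\<close> coordinates has two extensions to \<open>Suc k\<close>
  coordinates, and both occur equally often.\<close>

lemma extended_design_drop:
  assumes "extended_design K (Suc k) m n F"
  shows "extended_design K k m n F"
proof -
  have "2 ^ k * occurrences k m n F v = m * n" for v
  proof -
    have "2 * (2 ^ k * occurrences k m n F v) =
        2 ^ Suc k * occurrences (Suc k) m n F (v(k := True)) +
        2 ^ Suc k * occurrences (Suc k) m n F (v(k := False))"
      by (simp add: occurrences_Suc[of k] algebra_simps)
    also have "\<dots> = 2 * (m * n)"
      using assms unfolding extended_design_def by simp
    finally show ?thesis by simp
  qed
  then show ?thesis
    using assms strength2_mono[of n "Suc k"] by (auto simp: extended_design_def)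
qed

text \<open>After the surplus factors are dropped, the columns are cut down to \<open>l\<close> too:
  rows and columns are symmetric only when both parameters agree, as in
  \<open>extended_design_swap\<close>.\<close>

lemma extended_design_mono:
  assumes "extended_design K k m n F" "l \<le> k"
  shows "extended_design l l m n F"
proof -
  have "l \<le> k \<Longrightarrow> extended_design K l m n F"
    by (induction rule: inc_induct) (use assms(1) extended_design_drop in auto)
  then show ?thesis
    using assms(2) strength2_mono[of m K _ l] by (auto simp: extended_design_def)
qed

lemma extended_design_swap:
  assumes "extended_design k k m n F"
  shows "extended_design k k n m (\<lambda>i j. F j i)"
proof -
  have "occurrences k n m (\<lambda>i j. F j i) v = occurrences k m n F v" for v
    unfolding occurrences_def by (rule sum.swap)
  then show ?thesis
    using assms by (simp add: extended_design_def mult.commute)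
qed

lemma extended_design_append:
  assumes "extended_design K k m n F" "extended_design K k m n' G"
  shows "extended_design K k m (n + n') (\<lambda>i j. if j < n then F i j else G i (j - n))"
    (is "extended_design K k m _ ?H")
proof -
  have "occurrences k m (n + n') ?H v = occurrences k m n F v + occurrences k m n' G v" for v
    by (simp add: occurrences_def sum_lessThan_add sum.distrib)
  moreover have "strength2 m K (\<lambda>i. ?H i j)" if "j < n + n'" for j
    using assms that by (cases "j < n") (auto simp: extended_design_def)
  moreover have "strength2 (n + n') k (?H i)" if "i < m" for i
    using strength2_append[of n k "F i" n' "G i"] assms that by (simp add: extended_design_def)
  ultimately show ?thesis
    using assms by (simp add: extended_design_def algebra_simps)
qed

text \<open>The columns survive because flipping factor \<open>k\<close> is a translation, and by
  \<open>k < K\<close> they already have strength 2 with that factor included. Along a row, factor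
  \<open>k\<close> has opposite signs in the two halves, so all sums that involve it cancel.\<close>

lemma extended_design_double:
  assumes F: "extended_design K k m n F" and "k < K"
  shows "extended_design K (Suc k) m (2 * n)
    (\<lambda>i j c. if j < n then F i j c else F i (j - n) c \<noteq> (c = k))"
    (is "extended_design K _ m _ ?H")
proof -
  have cols: "strength2 m K (\<lambda>i. ?H i j)" if "j < 2 * n" for j
  proof (cases "j < n")
    case True
    then show ?thesis using F by (simp add: extended_design_def)
  next
    case False
    then have "strength2 m K (\<lambda>i. F i (j - n))"
      using F that by (simp add: extended_design_def)
    from strength2_translate[OF this] False show ?thesis by simp
  qed
  have rows: "strength2 (2 * n) (Suc k) (?H i)" if "i < m" for i
  proof -
    have Fi: "strength2 n k (F i)"
      using F that by (simp add: extended_design_def)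
    have 1: "(\<Sum>j<2 * n. sign (?H i j p)) = 0" if "p < Suc k" for p
      using Fi that unfolding mult_2 sum_lessThan_add
      by (cases "p = k") (simp_all add: strength2_def sum_negf)
    have 2: "(\<Sum>j<2 * n. sign (?H i j p) * sign (?H i j r)) = 0"
      if "p < Suc k" "r < Suc k" "p \<noteq> r" for p r
      using Fi that unfolding mult_2 sum_lessThan_add
      by (cases "p = k"; cases "r = k")
        (simp_all add: strength2_def sum_negf)
    show ?thesis
      using 1 2 by (simp add: strength2_def)
  qed
  have "2 ^ Suc k * occurrences (Suc k) m (2 * n) ?H v = m * (2 * n)" for v
  proof -
    \<comment> \<open>A cell that agrees with \<open>v\<close> below \<open>k\<close> matches
      \<open>v\<close> at \<open>k\<close> in exactly one of the two halves.\<close>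
    have "of_bool (\<forall>c<Suc k. F i j c = v c) +
        of_bool (\<forall>c<Suc k. (F i j c \<noteq> (c = k)) = v c) =
        (of_bool (\<forall>c<k. F i j c = v c) :: nat)" for i j
      by (auto simp: less_Suc_eq)
    then have "occurrences (Suc k) m (2 * n) ?H v = occurrences k m n F v"
      unfolding occurrences_def mult_2 sum_lessThan_add
      by (simp add: sum.distrib[symmetric] del: sum_of_bool_eq)
    then show ?thesis
      using F by (simp add: extended_design_def)
  qed
  then show ?thesis
    using cols rows \<open>k < K\<close> by (simp add: extended_design_def)
qed

section \<open>Closure rules for the parameters\<close>

definition extensible :: "nat \<Rightarrow> nat \<Rightarrow> nat \<Rightarrow> nat \<Rightarrow> bool" where
  "extensible K k m n \<longleftrightarrow> (\<exists>F. extended_design K k m n F)"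

lemma extensible_mono: "extensible K k m n \<Longrightarrow> l \<le> k \<Longrightarrow> extensible l l m n"
  by (auto simp: extensible_def intro: extended_design_mono)

lemma extensible_swap: "extensible k k m n \<Longrightarrow> extensible k k n m"
  by (auto simp: extensible_def intro: extended_design_swap)

lemma extensible_append:
  "extensible K k m n \<Longrightarrow> extensible K k m n' \<Longrightarrow> extensible K k m (n + n')"
  by (auto simp: extensible_def intro: extended_design_append)

lemma extensible_mult:
  assumes "extensible K k m n" "0 < c"
  shows "extensible K k m (c * n)"
  using assms(2)
proof (induction c rule: nat_induct_non_zero)
  case (Suc c)
  then show ?case using extensible_append[OF assms(1)] by simp
qed (simp add: assms(1))

lemma extensible_double:
  assumes "extensible K k m n" "k + e \<le> K"
  shows "extensible K (k + e) m (2 ^ e * n)"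
  using assms(2)
proof (induction e)
  case (Suc e)
  then show ?case
    using extended_design_double[of K "k + e" m "2 ^ e * n"]
    by (auto simp: extensible_def mult.assoc)
qed (simp add: assms(1))

text \<open>Doubling continues until the power of 2 is used up or the number of factors reaches
  \<open>K\<close>; copies side by side supply the rest of \<open>2 ^ a * b\<close>.\<close>

lemma extensible_power:
  assumes "extensible K l m (2 ^ d)" "l \<le> K" "d \<le> a" "k \<le> K" "k \<le> l + (a - d)" "0 < b"
  shows "extensible k k m (2 ^ a * b)"
proof -
  define e where "e = min (a - d) (K - l)"
  have "extensible K (l + e) m (2 ^ e * 2 ^ d)"
    using assms(1,2) by (intro extensible_double) (auto simp: e_def)
  then have "extensible K (l + e) m (2 ^ (a - d - e) * b * (2 ^ e * 2 ^ d))"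
    by (rule extensible_mult) (use assms(6) in simp)
  moreover have "(2::nat) ^ (a - d - e) * b * (2 ^ e * 2 ^ d) = 2 ^ a * b"
  proof -
    have "a = (a - d - e) + e + d"
      using assms(3) by (simp add: e_def)
    then have "(2::nat) ^ a = 2 ^ (a - d - e) * 2 ^ e * 2 ^ d"
      by (metis power_add)
    then show ?thesis by simp
  qed
  ultimately have "extensible K (l + e) m (2 ^ a * b)" by (simp only:)
  then show ?thesis
    by (rule extensible_mono) (use assms in \<open>auto simp: e_def\<close>)
qed

text \<open>For odd \<open>b\<close> the number \<open>4 * b\<close> is 4 modulo 8, so one block of
  12 columns corrects the residue and blocks of 8 fill the rest.\<close>

lemma extensible_12_8_sum:
  assumes "extensible k k m 12" "extensible k k m 8" "odd b" "3 \<le> b"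
  shows "extensible k k m (4 * b)"
proof -
  define s where "s = (b - 3) div 2"
  have b: "4 * b = 12 + s * 8"
    using assms(3,4) unfolding s_def by presburger
  show ?thesis
  \<comment> \<open>\<open>extensible_mult\<close> wants a positive number of copies.\<close>
  proof (cases "s = 0")
    case False
    then show ?thesis
      unfolding b by (intro extensible_append extensible_mult assms) simp
  qed (use b assms(1) in simp)
qed

section \<open>Indicator sums and Rao's bound\<close>

lemma card_eq_sum_of_bool:
  fixes n :: nat
  shows "card {i. i < n \<and> P i} = (\<Sum>i<n. of_bool (P i))"
proof -
  have "{i. i < n \<and> P i} = {..<n} \<inter> {i. P i}" by auto
  then show ?thesis by simp
qed

lemma strength2_rao:
  assumes A: "strength2 n k A" and "0 < n"
  shows "k + 1 \<le> n"
proof -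
  \<comment> \<open>Index \<open>k\<close> is a constant column. With it the \<open>k + 1\<close>
    columns are pairwise orthogonal, which expresses both conditions of \<open>strength2\<close> at
    once.\<close>
  define a where "a i p = (if p = k then 1 else sign (A i p))" for i p
  have sq [simp]: "a i p * a i p = 1" for i p
    by (simp add: a_def)
  have orth: "(\<Sum>i<n. a i p * a i r) = (if p = r then int n else 0)"
    if "p < Suc k" "r < Suc k" for p r
    using A that by (auto simp: strength2_def a_def less_Suc_eq)
  have "(\<Sum>i<n. (\<Sum>p<Suc k. a 0 p * a i p)\<^sup>2) =
      (\<Sum>i<n. \<Sum>p<Suc k. \<Sum>r<Suc k. a 0 p * a 0 r * (a i p * a i r))"
    unfolding power2_eq_square sum_product by (intro sum.cong refl) (simp add: algebra_simps)
  also have "\<dots> = (\<Sum>p<Suc k. \<Sum>r<Suc k. \<Sum>i<n. a 0 p * a 0 r * (a i p * a i r))"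
  proof -
    have "(\<Sum>i<n. \<Sum>p<Suc k. \<Sum>r<Suc k. f i p r) = (\<Sum>p<Suc k. \<Sum>r<Suc k. \<Sum>i<n. f i p r)"
      for f :: "nat \<Rightarrow> nat \<Rightarrow> nat \<Rightarrow> int"
    proof -
      have "(\<Sum>i<n. \<Sum>p<Suc k. \<Sum>r<Suc k. f i p r) = (\<Sum>p<Suc k. \<Sum>i<n. \<Sum>r<Suc k. f i p r)"
        by (rule sum.swap)
      also have "\<dots> = (\<Sum>p<Suc k. \<Sum>r<Suc k. \<Sum>i<n. f i p r)"
        by (rule sum.cong[OF refl]) (rule sum.swap)
      finally show ?thesis .
    qed
    then show ?thesis .
  qed
  also have "\<dots> = (\<Sum>p<Suc k. \<Sum>r<Suc k. a 0 p * a 0 r * (if p = r then int n else 0))"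
    by (intro sum.cong refl) (simp add: sum_distrib_left[symmetric] orth del: sum.lessThan_Suc)
  also have "\<dots> = (\<Sum>p<Suc k. int n)"
    by (intro sum.cong refl) (simp add: if_distrib[of "\<lambda>x. _ * x"] del: sum.lessThan_Suc cong: if_cong)
  finally have total: "(\<Sum>i<n. (\<Sum>p<Suc k. a 0 p * a i p)\<^sup>2) = int (Suc k) * int n"
    by simp
  \<comment> \<open>Row 0 alone contributes \<open>(k + 1)^2\<close> to a sum of squares whose total
    is \<open>(k + 1) * n\<close>.\<close>
  have "(int (Suc k))\<^sup>2 = (\<Sum>p<Suc k. a 0 p * a 0 p)\<^sup>2"
    by simp
  also have "\<dots> \<le> (\<Sum>i<n. (\<Sum>p<Suc k. a 0 p * a i p)\<^sup>2)"
    by (rule member_le_sum[of 0 "{..<n}" "\<lambda>i. (\<Sum>p<Suc k. a 0 p * a i p)\<^sup>2"]) (use \<open>0 < n\<close> in auto)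
  also note total
  finally have "int (Suc k) \<le> int n"
    unfolding power2_eq_square by (rule mult_left_le_imp_le) simp
  then show ?thesis by simp
qed

section \<open>Orthogonal arrays on two levels and Boolean arrays\<close>

lemma restrict_pair_eq_iff:
  assumes "v \<in> {p, r} \<rightarrow>\<^sub>E T"
  shows "restrict f {p, r} = v \<longleftrightarrow> f p = v p \<and> f r = v r"
proof
  assume "restrict f {p, r} = v"
  then show "f p = v p \<and> f r = v r"
    by (auto dest: fun_cong[of _ _ p] fun_cong[of _ _ r] simp: restrict_apply split: if_splits)
next
  assume "f p = v p \<and> f r = v r"
  then show "restrict f {p, r} = v"
    using assms by (auto simp: PiE_iff extensional_def restrict_def fun_eq_iff)
qed

lemma orthogonal_array_pair:
  assumes "orthogonal_array n k 2 2 A" "p < k" "r < k" "p \<noteq> r"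
  shows "4 * (\<Sum>i<n. of_bool ((A i p = 1) = x \<and> (A i r = 1) = y)) = n"
proof -
  define v where "v = restrict (\<lambda>c. of_bool (if c = p then x else y) :: nat) {p, r}"
  have v: "v \<in> {p, r} \<rightarrow>\<^sub>E {..<2}"
    by (auto simp: v_def)
  have "card {i. i < n \<and> restrict (A i) {p, r} = v} * 2 ^ 2 = n"
    using assms v by (auto simp: orthogonal_array_def)
  moreover have "{i. i < n \<and> restrict (A i) {p, r} = v} =
      {i. i < n \<and> ((A i p = 1) = x \<and> (A i r = 1) = y)}"
  proof -
    have "A i p < 2 \<and> A i r < 2" if "i < n" for i
      using assms that by (auto simp: orthogonal_array_def level_vectors_def)
    then have "(A i p = v p \<and> A i r = v r) = ((A i p = 1) = x \<and> (A i r = 1) = y)" if "i < n" for i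
      using that assms(4) by (cases x; cases y) (auto simp: v_def less_2_cases_iff)
    then show ?thesis
      unfolding restrict_pair_eq_iff[OF v] by blast
  qed
  ultimately show ?thesis
    by (simp add: card_eq_sum_of_bool)
qed

text \<open>The sign of a column, like the product of two, is a combination of the indicators of the
  four value pairs with two coefficients 1 and two -1, and each pair occurs \<open>n / 4\<close>
  times.\<close>

lemma orthogonal_array_imp_strength2:
  assumes A: "orthogonal_array n k 2 2 A"
  shows "strength2 n k (\<lambda>i p. A i p = 1)"
proof -
  let ?N = "\<lambda>p r x y. (\<Sum>i<n. of_bool ((A i p = 1) = x \<and> (A i r = 1) = y))"
  have N: "4 * ?N p r x y = int n" if "p < k" "r < k" "p \<noteq> r" for p r x y
    using orthogonal_array_pair[OF A that, of x y] by (simp flip: of_nat_sum)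
  have 1: "(\<Sum>i<n. sign (A i p = 1)) = 0" if "p < k" for p
  proof -
    \<comment> \<open>Strength \<open>t = 2\<close> includes \<open>2 \<le> k\<close>, so column
      \<open>p\<close> has a partner to form pairs with.\<close>
    obtain r where r: "r < k" "r \<noteq> p"
      using A that by (metis orthogonal_array_def One_nat_def Suc_1 Suc_le_eq less_2_cases_iff
          less_le_trans nat_neq_iff zero_less_one)
    have "sign (A i p = 1) = of_bool ((A i p = 1) = False \<and> (A i r = 1) = False)
        + of_bool ((A i p = 1) = False \<and> (A i r = 1) = True)
        - of_bool ((A i p = 1) = True \<and> (A i r = 1) = False)
        - of_bool ((A i p = 1) = True \<and> (A i r = 1) = True)" for i
      by (auto simp: sign_def)
    then have "(\<Sum>i<n. sign (A i p = 1)) =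
        ?N p r False False + ?N p r False True - ?N p r True False - ?N p r True True"
      by (simp only: sum.distrib sum_subtractf)
    then show ?thesis
      using N[OF that r(1), of False False] N[OF that r(1), of False True]
        N[OF that r(1), of True False] N[OF that r(1), of True True] r(2) by linarith
  qed
  have 2: "(\<Sum>i<n. sign (A i p = 1) * sign (A i r = 1)) = 0" if "p < k" "r < k" "p \<noteq> r" for p r
  proof -
    have "sign (A i p = 1) * sign (A i r = 1) =
        of_bool ((A i p = 1) = False \<and> (A i r = 1) = False)
        - of_bool ((A i p = 1) = False \<and> (A i r = 1) = True)
        - of_bool ((A i p = 1) = True \<and> (A i r = 1) = False)
        + of_bool ((A i p = 1) = True \<and> (A i r = 1) = True)" for i
      by (auto simp: sign_def)
    then have "(\<Sum>i<n. sign (A i p = 1) * sign (A i r = 1)) =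
        ?N p r False False - ?N p r False True - ?N p r True False + ?N p r True True"
      by (simp only: sum.distrib sum_subtractf)
    then show ?thesis
      using N[OF that, of False False] N[OF that, of False True]
        N[OF that, of True False] N[OF that, of True True] by linarith
  qed
  show ?thesis
    using 1 2 by (simp add: strength2_def)
qed

definition level_vector :: "nat \<Rightarrow> (nat \<Rightarrow> bool) \<Rightarrow> nat \<Rightarrow> nat" where
  "level_vector k f = restrict (\<lambda>c. of_bool (f c)) {..<k}"

lemma level_vector_in: "level_vector k f \<in> level_vectors 2 k"
  by (auto simp: level_vector_def level_vectors_def)

lemma level_vector_eq_iff:
  assumes "v \<in> level_vectors 2 k"
  shows "level_vector k f = v \<longleftrightarrow> (\<forall>c<k. f c = (v c = 1))"
proof
  assume "level_vector k f = v"
  then show "\<forall>c<k. f c = (v c = 1)"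
    by (auto simp: level_vector_def of_bool_def split: if_splits)
next
  assume *: "\<forall>c<k. f c = (v c = 1)"
  show "level_vector k f = v"
  proof
    fix c
    show "level_vector k f c = v c"
    proof (cases "c < k")
      case True
      then have "v c < 2"
        using assms by (auto simp: level_vectors_def)
      then show ?thesis
        using * True by (auto simp: level_vector_def less_2_cases_iff)
    next
      case False
      then show ?thesis
        using assms by (auto simp: level_vector_def level_vectors_def PiE_iff extensional_def)
    qed
  qed
qed

lemma strength2_imp_orthogonal_array:
  assumes A: "strength2 n k A" and "2 \<le> k"
  shows "orthogonal_array n k 2 2 (\<lambda>i. level_vector k (A i))"
proof -
  have "card {i. i < n \<and> restrict (level_vector k (A i)) S = v} * 2 ^ 2 = n"
    if S: "S \<subseteq> {..<k}" "card S = 2" and v: "v \<in> S \<rightarrow>\<^sub>E {..<2}" for S v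
  proof -
    obtain p r where pr: "S = {p, r}" "p \<noteq> r"
      using S(2) by (auto simp: card_2_iff)
    then have less: "p < k" "r < k"
      using S(1) by auto
    have "level_vector k (A i) p = v p \<longleftrightarrow> A i p = (v p = 1)"
      "level_vector k (A i) r = v r \<longleftrightarrow> A i r = (v r = 1)" for i
    proof -
      have "v p < 2" "v r < 2"
        using v pr by auto
      then show "level_vector k (A i) p = v p \<longleftrightarrow> A i p = (v p = 1)"
        "level_vector k (A i) r = v r \<longleftrightarrow> A i r = (v r = 1)"
        using less by (auto simp: level_vector_def less_2_cases_iff)
    qed
    then have "{i. i < n \<and> restrict (level_vector k (A i)) S = v} =
        {i. i < n \<and> (A i p = (v p = 1) \<and> A i r = (v r = 1))}"
      using restrict_pair_eq_iff[OF v[unfolded pr(1)]] pr(1) by simp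
    then have card: "card {i. i < n \<and> restrict (level_vector k (A i)) S = v} =
        (\<Sum>i<n. of_bool (A i p = (v p = 1) \<and> A i r = (v r = 1)))"
      by (simp only: card_eq_sum_of_bool)
    \<comment> \<open>The indicator of a value pair expanded in the four characters of the group of
      order 4. Summed over the rows, only the constant term survives.\<close>
    have "4 * of_bool (x = a \<and> y = b) =
        1 + sign a * sign x + sign b * sign y + sign a * sign b * (sign x * sign y)" for x y a b
      by (simp add: sign_def)
    then have "4 * (\<Sum>i<n. of_bool (A i p = (v p = 1) \<and> A i r = (v r = 1))) = 
        (\<Sum>i<n. 1 + sign (v p = 1) * sign (A i p) + sign (v r = 1) * sign (A i r)
          + sign (v p = 1) * sign (v r = 1) * (sign (A i p) * sign (A i r)))"
      by (simp only: sum_distrib_left)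
    also have "\<dots> = int n"
      using A less pr(2)
      by (simp add: sum.distrib sum_distrib_left[symmetric] strength2_def)
    finally have "4 * int (\<Sum>i<n. of_bool (A i p = (v p = 1) \<and> A i r = (v r = 1))) = int n"
      by (simp only: of_nat_sum of_nat_of_bool)
    then show ?thesis
      unfolding card by simp
  qed
  then show ?thesis
    using \<open>2 \<le> k\<close> level_vector_in by (auto simp: orthogonal_array_def)
qed

lemma extensible_imp_factorial_design:
  assumes "extensible K k m n" "2 \<le> k"
  shows "\<exists>F. factorial_design k m n 2 2 F"
proof -
  have "extensible k k m n"
    using assms(1) by (rule extensible_mono) simp
  then obtain F where F: "extended_design k k m n F"
    by (auto simp: extensible_def)
  have "card {(i, j). i < m \<and> j < n \<and> level_vector k (F i j) = v} * 2 ^ k = m * n"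
    if "v \<in> level_vectors 2 k" for v
  proof -
    have "{(i, j). i < m \<and> j < n \<and> level_vector k (F i j) = v} =
        (SIGMA i:{..<m}. {j. j < n \<and> (\<forall>c<k. F i j c = (v c = 1))})"
      by (auto simp: level_vector_eq_iff[OF that])
    also have "card \<dots> = occurrences k m n F (\<lambda>c. v c = 1)"
      unfolding occurrences_def card_eq_sum_of_bool[symmetric] by (rule card_SigmaI) auto
    finally show ?thesis
      using F by (simp add: extended_design_def mult.commute)
  qed
  moreover have "\<forall>i<m. orthogonal_array n k 2 2 (\<lambda>j. level_vector k (F i j))"
    "\<forall>j<n. orthogonal_array m k 2 2 (\<lambda>i. level_vector k (F i j))"
    using F assms(2) by (auto simp: extended_design_def intro: strength2_imp_orthogonal_array)
  ultimately have "factorial_design k m n 2 2 (\<lambda>i j. level_vector k (F i j))"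
    using level_vector_in by (simp add: factorial_design_def)
  then show ?thesis by blast
qed

section \<open>Evaluation of balance and uniformity on lists\<close>

definition balanced :: "bool list \<Rightarrow> bool" where
  "balanced xs \<longleftrightarrow> 2 * length (filter id xs) = length xs"

text \<open>The exclusive or of two columns is balanced iff the product of their signs sums to 0;
  \<open>sorted_wrt\<close> visits each pair once.\<close>

definition pairwise_balanced :: "bool list list \<Rightarrow> bool" where
  "pairwise_balanced cs \<longleftrightarrow>
     list_all balanced cs \<and> sorted_wrt (\<lambda>x y. balanced (map2 (\<noteq>) x y)) cs"

definition columns :: "nat \<Rightarrow> nat \<Rightarrow> (nat \<Rightarrow> nat \<Rightarrow> bool) \<Rightarrow> bool list list" where
  "columns n k A = map (\<lambda>c. map (\<lambda>i. A i c) [0..<n]) [0..<k]"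

lemma balanced_map_iff: "balanced (map f [0..<n]) \<longleftrightarrow> (\<Sum>i<n. sign (f i)) = 0"
proof -
  have "(\<Sum>i<n. sign (f i)) = int n - 2 * int (length (filter id (map f [0..<n])))"
    by (induction n) (auto simp: sign_def)
  then show ?thesis
    by (simp add: balanced_def) linarith
qed

lemma pairwise_balanced_imp_strength2:
  assumes "pairwise_balanced (columns n k A)"
  shows "strength2 n k A"
proof -
  have 1: "(\<Sum>i<n. sign (A i p)) = 0" if "p < k" for p
    using assms that
    by (simp add: pairwise_balanced_def columns_def list_all_length balanced_map_iff)
  have 2: "(\<Sum>i<n. sign (A i p) * sign (A i r)) = 0" if "p < r" "r < k" for p r
  proof -
    have "balanced (map2 (\<noteq>) (map (\<lambda>i. A i p) [0..<n]) (map (\<lambda>i. A i r) [0..<n]))"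
      using assms that by (simp add: pairwise_balanced_def columns_def sorted_wrt_iff_nth_less)
    then have "balanced (map (\<lambda>i. A i p \<noteq> A i r) [0..<n])"
      by (simp add: map2_map_map)
    then show ?thesis
      by (simp add: balanced_map_iff sign_eq_not)
  qed
  show ?thesis
    unfolding strength2_def
  proof (intro conjI allI impI)
    fix p r assume "p < k" "r < k" "p \<noteq> r"
    then show "(\<Sum>i<n. sign (A i p) * sign (A i r)) = 0"
      using 2[of p r] 2[of r p] by (cases "p < r") (simp_all add: mult.commute)
  qed (simp add: 1)
qed

text \<open>Branching on the heads counts every vector with one pass over the list per coordinate.\<close>

primrec uniform :: "nat \<Rightarrow> nat \<Rightarrow> bool list list \<Rightarrow> bool" where
  "uniform l 0 xs \<longleftrightarrow> length xs = l"
| "uniform l (Suc k) xs \<longleftrightarrow>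
     uniform l k (map tl (filter hd xs)) \<and> uniform l k (map tl (filter (Not \<circ> hd) xs))"

lemma uniform_imp_length_filter:
  assumes "uniform l k xs" "length v = k" "\<forall>x\<in>set xs. length x = k"
  shows "length (filter (\<lambda>x. x = v) xs) = l"
  using assms
proof (induction k arbitrary: xs v)
  case 0
  then have "filter (\<lambda>x. x = v) xs = xs"
    by (intro filter_True) auto
  with 0 show ?case by simp
next
  case (Suc k)
  then obtain b u where v: "v = b # u" "length u = k"
    by (auto simp: length_Suc_conv)
  \<comment> \<open>The tails of the vectors that start with \<open>b\<close>. The recursion of
    \<open>uniform\<close> covers them for either value of \<open>b\<close>, and \<open>u\<close>
    occurs here as often as \<open>v\<close> in \<open>xs\<close>.\<close>
  define ys where "ys = map tl (filter (\<lambda>x. hd x = b) xs)"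
  have "ys = (if b then map tl (filter hd xs) else map tl (filter (Not \<circ> hd) xs))"
    by (auto simp: ys_def comp_def)
  then have "length (filter (\<lambda>x. x = u) ys) = l"
    using Suc.prems v(2) by (intro Suc.IH) (auto simp: ys_def)
  moreover have "filter (\<lambda>x. x = v) xs = filter (\<lambda>x. hd x = b \<and> tl x = u) xs"
  proof (intro filter_cong refl)
    fix x assume "x \<in> set xs"
    then have "x \<noteq> []"
      using Suc.prems(3) by auto
    then show "(x = v) = (hd x = b \<and> tl x = u)"
      using v(1) by (cases x) auto
  qed
  ultimately show ?case
    by (simp add: ys_def filter_map comp_def conj_commute)
qed

definition cells :: "nat \<Rightarrow> nat \<Rightarrow> nat \<Rightarrow> (nat \<Rightarrow> nat \<Rightarrow> nat \<Rightarrow> bool) \<Rightarrow> bool list list" where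
  "cells k m n F = concat (map (\<lambda>i. map (\<lambda>j. map (F i j) [0..<k]) [0..<n]) [0..<m])"

lemma occurrences_eq_length_filter:
  "occurrences k m n F v = length (filter (\<lambda>x. x = map v [0..<k]) (cells k m n F))"
proof -
  have "length (filter P (map f [0..<n])) = (\<Sum>j<n. of_bool (P (f j)))"
    for P and f :: "nat \<Rightarrow> bool list" and n
    by (induction n) auto
  moreover have "length (filter P (concat (map g [0..<m]))) = (\<Sum>i<m. length (filter P (g i)))"
    for P and g :: "nat \<Rightarrow> bool list list"
    by (induction m) auto
  moreover have "map f [0..<k] = map v [0..<k] \<longleftrightarrow> (\<forall>c<k. f c = v c)" for f
    by (auto simp: list_eq_iff_nth_eq)
  ultimately show ?thesis
    unfolding cells_def occurrences_def by (simp only:)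
qed

text \<open>Rows and cells are left to evaluation. The columns are a separate hypothesis, because
  for translates they all follow from a single array.\<close>

lemma extended_designI:
  assumes "k \<le> K" "\<And>j. j < n \<Longrightarrow> strength2 m K (\<lambda>i. F i j)"
    and rows: "list_all (\<lambda>i. pairwise_balanced (columns n k (F i))) [0..<m]"
    and cells: "uniform l k (cells k m n F)" "2 ^ k * l = m * n"
  shows "extended_design K k m n F"
proof -
  have "\<forall>x\<in>set (cells k m n F). length x = k"
    by (auto simp: cells_def)
  then have "occurrences k m n F v = l" for v
    using uniform_imp_length_filter[OF cells(1), of "map v [0..<k]"]
    by (simp add: occurrences_eq_length_filter)
  then show ?thesis
    using assms by (auto simp: extended_design_def list_all_iff intro: pairwise_balanced_imp_strength2)
qed

section \<open>Designs whose columns are translates of one array\<close>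

definition translates ::
  "(nat \<Rightarrow> nat \<Rightarrow> bool) \<Rightarrow> (nat \<Rightarrow> nat \<Rightarrow> nat) \<Rightarrow> (nat \<Rightarrow> nat \<Rightarrow> bool) \<Rightarrow> nat \<Rightarrow> nat \<Rightarrow> nat \<Rightarrow> bool"
  where "translates H f w i j c \<longleftrightarrow> H (f i j) c \<noteq> w j c"

text \<open>The test is that each index is hit; \<open>m\<close> values have room for nothing else,
  so every column of \<open>f\<close> is a permutation.\<close>

definition permutation_table :: "nat \<Rightarrow> nat \<Rightarrow> (nat \<Rightarrow> nat \<Rightarrow> nat) \<Rightarrow> bool" where
  "permutation_table m n f \<longleftrightarrow>
     list_all (\<lambda>j. list_all (\<lambda>x. x \<in> set (map (\<lambda>i. f i j) [0..<m])) [0..<m]) [0..<n]"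

lemma extensible_translates:
  assumes "k \<le> K" "pairwise_balanced (columns m K H)"
    and f: "permutation_table m n f"
    and "list_all (\<lambda>i. pairwise_balanced (columns n k (translates H f w i))) [0..<m]"
    and "uniform l k (cells k m n (translates H f w))" "2 ^ k * l = m * n"
  shows "extensible K k m n"
proof -
  have "strength2 m K (\<lambda>i. translates H f w i j)" if "j < n" for j
  proof -
    have sub: "{..<m} \<subseteq> (\<lambda>i. f i j) ` {..<m}"
    proof
      fix x assume "x \<in> {..<m}"
      then have "x \<in> set (map (\<lambda>i. f i j) [0..<m])"
        using f that by (simp add: permutation_table_def list_all_iff atLeast0LessThan)
      then show "x \<in> (\<lambda>i. f i j) ` {..<m}"
        by (simp add: atLeast0LessThan)
    qed
    moreover have "card ((\<lambda>i. f i j) ` {..<m}) = card {..<m}"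
      using card_mono[OF _ sub] card_image_le[of "{..<m}" "\<lambda>i. f i j"] by simp
    ultimately have "bij_betw (\<lambda>i. f i j) {..<m} {..<m}"
      using card_subset_eq[of "(\<lambda>i. f i j) ` {..<m}" "{..<m}"]
      by (simp add: bij_betw_def eq_card_imp_inj_on)
    from strength2_translate[OF strength2_permute[OF pairwise_balanced_imp_strength2[OF assms(2)] this]]
    show ?thesis
      by (simp only: translates_def[abs_def])
  qed
  then have "extended_design K k m n (translates H f w)"
    by (rule extended_designI[OF assms(1) _ assms(4-6)])
  then show ?thesis
    by (auto simp: extensible_def)
qed

section \<open>The six explicit designs\<close>

primrec word :: "int \<Rightarrow> nat \<Rightarrow> bool" where
  "word x 0 \<longleftrightarrow> odd x"
| "word x (Suc c) \<longleftrightarrow> word (x div 2) c"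

text \<open>Row 0 is constant and the rows from 1 to \<open>length bs\<close> are the cyclic shifts
  of \<open>bs\<close>. For the sequences below, adjoining a constant column gives a normalized
  Hadamard matrix.\<close>

definition bordered_circulant :: "bool list \<Rightarrow> nat \<Rightarrow> nat \<Rightarrow> bool" where
  "bordered_circulant bs i c \<longleftrightarrow> 0 < i \<and> bs ! ((c + i) mod length bs)"

text \<open>
  The generating sequences of the bordered circulants are \<open>m\<close>-sequences of periods 3, 7 and 15, and
  the indicator sequences of \<open>{0}\<close> and the quadratic nonresidues modulo 11 and 19. For orders 4,
  8 and 16 the rows of \<open>H\<close> form a linear code, as do the translations; for 8 and 16 the two
  codes are complementary in the first \<open>k\<close> coordinates. For orders 12 and 20 the rows of \<open>H\<close> are split
  into tetrads on which the first two coordinates take all four values, and the translations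
  are the 8 words supported on coordinates 2, 3 and 4. The sums of a tetrad and the translations
  exhaust the words of length 5; four rows of the design carry them, one row for each coset of
  a 3-dimensional code of strength 2.
\<close>

lemma extensible_4_4: "extensible 3 2 4 4"
proof -
  define H where "H = bordered_circulant (map odd [0, 1, 1 :: int])"
  define f :: "nat \<Rightarrow> nat \<Rightarrow> nat" where "f = (\<lambda>i j. i)"
  \<comment> \<open>Bits, lowest first, are coordinates. In the first two coordinates both the rows
    of \<open>H\<close> and the translations run through all words, so each word occurs 4
    times.\<close>
  define w where "w = (\<lambda>j. word ([0, 2, 1, 3] ! j))"
  have "pairwise_balanced (columns 4 3 H)"
    unfolding H_def by code_simp
  moreover have "permutation_table 4 4 f"
    unfolding f_def by code_simp
  moreover have "list_all (\<lambda>i. pairwise_balanced (columns 4 2 (translates H f w i))) [0..<4]"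
    unfolding H_def f_def w_def by code_simp
  moreover have "uniform 4 2 (cells 2 4 4 (translates H f w))"
    unfolding H_def f_def w_def by code_simp
  ultimately show ?thesis
    \<comment> \<open>The rotation puts \<open>k \<le> K\<close> last, so that the evaluated facts
      meet the premises in order.\<close>
    by (rule extensible_translates[rotated]) simp_all
qed

lemma extensible_8_8: "extensible 7 6 8 8"
proof -
  define H where "H = bordered_circulant (map odd [1, 1, 1, 0, 1, 0, 0 :: int])"
  define f :: "nat \<Rightarrow> nat \<Rightarrow> nat" where "f = (\<lambda>i j. i)"
  define w where "w = (\<lambda>j. word ([0, 26, 54, 44, 7, 29, 49, 43] ! j))"
  have "pairwise_balanced (columns 8 7 H)"
    unfolding H_def by code_simp
  moreover have "permutation_table 8 8 f"
    unfolding f_def by code_simp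
  moreover have "list_all (\<lambda>i. pairwise_balanced (columns 8 6 (translates H f w i))) [0..<8]"
    unfolding H_def f_def w_def by code_simp
  moreover have "uniform 1 6 (cells 6 8 8 (translates H f w))"
    unfolding H_def f_def w_def by code_simp
  ultimately show ?thesis
    by (rule extensible_translates[rotated]) simp_all
qed

lemma extensible_16_16: "extensible 15 8 16 16"
proof -
  define H where "H = bordered_circulant (map odd [1, 1, 1, 1, 0, 1, 0, 1, 1, 0, 0, 1, 0, 0, 0 :: int])"
  define f :: "nat \<Rightarrow> nat \<Rightarrow> nat" where "f = (\<lambda>i j. i)"
  define w where "w = (\<lambda>j. word ([0, 195, 110, 173, 216, 27, 182, 117, 14, 205, 96, 163, 214, 21, 184, 123] ! j))"
  have "pairwise_balanced (columns 16 15 H)"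
    unfolding H_def by code_simp
  moreover have "permutation_table 16 16 f"
    unfolding f_def by code_simp
  moreover have "list_all (\<lambda>i. pairwise_balanced (columns 16 8 (translates H f w i))) [0..<16]"
    unfolding H_def f_def w_def by code_simp
  moreover have "uniform 1 8 (cells 8 16 16 (translates H f w))"
    unfolding H_def f_def w_def by code_simp
  ultimately show ?thesis
    by (rule extensible_translates[rotated]) simp_all
qed

lemma extensible_12_8: "extensible 11 5 12 8"
proof -
  define H where "H = bordered_circulant (map odd [1, 0, 1, 0, 0, 0, 1, 1, 1, 0, 1 :: int])"
  \<comment> \<open>The rows come in blocks of four; within a block every column permutes the
    indices of one tetrad.\<close>
  define f :: "nat \<Rightarrow> nat \<Rightarrow> nat" where "f = (\<lambda>i j. [
    [0, 9, 9, 0, 7, 8, 8, 7], [7, 8, 8, 7, 0, 9, 9, 0], [9, 0, 0, 9, 8, 7, 7, 8], [8, 7, 7, 8, 9, 0, 0, 9],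
    [4, 10, 5, 11, 11, 5, 10, 4], [5, 11, 4, 10, 10, 4, 11, 5], [10, 4, 11, 5, 5, 11, 4, 10], [11, 5, 10, 4, 4, 10, 5, 11],
    [2, 3, 1, 6, 6, 1, 3, 2], [6, 1, 3, 2, 2, 3, 1, 6], [1, 6, 2, 3, 3, 2, 6, 1], [3, 2, 6, 1, 1, 6, 2, 3]] ! i ! j)"
  define w where "w = (\<lambda>j. word ([0, 4, 8, 12, 16, 20, 24, 28] ! j))"
  have "pairwise_balanced (columns 12 11 H)"
    unfolding H_def by code_simp
  moreover have "permutation_table 12 8 f"
    unfolding f_def by code_simp
  moreover have "list_all (\<lambda>i. pairwise_balanced (columns 8 5 (translates H f w i))) [0..<12]"
    unfolding H_def f_def w_def by code_simp
  moreover have "uniform 3 5 (cells 5 12 8 (translates H f w))"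
    unfolding H_def f_def w_def by code_simp
  ultimately show ?thesis
    by (rule extensible_translates[rotated]) simp_all
qed

lemma extensible_20_8: "extensible 19 5 20 8"
proof -
  define H where "H = bordered_circulant (map odd [1, 0, 1, 1, 0, 0, 0, 0, 1, 0, 1, 0, 1, 1, 1, 1, 0, 0, 1 :: int])"
  define f :: "nat \<Rightarrow> nat \<Rightarrow> nat" where "f = (\<lambda>i j. [
    [0, 17, 17, 0, 18, 19, 19, 18], [18, 19, 19, 18, 0, 17, 17, 0], [17, 0, 0, 17, 19, 18, 18, 19], [19, 18, 18, 19, 17, 0, 0, 17],
    [14, 15, 11, 16, 11, 16, 14, 15], [15, 14, 16, 11, 16, 11, 15, 14], [11, 16, 14, 15, 14, 15, 11, 16], [16, 11, 15, 14, 15, 14, 16, 11],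
    [9, 12, 6, 10, 10, 6, 12, 9], [10, 6, 12, 9, 9, 12, 6, 10], [12, 9, 10, 6, 6, 10, 9, 12], [6, 10, 9, 12, 12, 9, 10, 6],
    [13, 8, 5, 1, 1, 5, 8, 13], [1, 5, 8, 13, 13, 8, 5, 1], [5, 1, 13, 8, 8, 13, 1, 5], [8, 13, 1, 5, 5, 1, 13, 8],
    [2, 7, 4, 3, 4, 3, 2, 7], [3, 4, 7, 2, 7, 2, 3, 4], [4, 3, 2, 7, 2, 7, 4, 3], [7, 2, 3, 4, 3, 4, 7, 2]] ! i ! j)"
  define w where "w = (\<lambda>j. word ([0, 4, 8, 12, 16, 20, 24, 28] ! j))"
  have "pairwise_balanced (columns 20 19 H)"
    unfolding H_def by code_simp
  moreover have "permutation_table 20 8 f"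
    unfolding f_def by code_simp
  moreover have "list_all (\<lambda>i. pairwise_balanced (columns 8 5 (translates H f w i))) [0..<20]"
    unfolding H_def f_def w_def by code_simp
  moreover have "uniform 5 5 (cells 5 20 8 (translates H f w))"
    unfolding H_def f_def w_def by code_simp
  ultimately show ?thesis
    by (rule extensible_translates[rotated]) simp_all
qed

text \<open>
  The table was found by a SAT solver under the symmetry that moving 4 rows down and 4 columns to
  the right permutes the first three coordinates cyclically.
\<close>

lemma extensible_12_12: "extensible 4 4 12 12"
proof -
  define F where "F = (\<lambda>i j. word ([
    [0, 10, 12, 2, 4, 1, 13, 7, 14, 9, 7, 11],
    [3, 1, 6, 12, 11, 15, 6, 13, 5, 10, 0, 8],
    [7, 6, 10, 1, 9, 5, 12, 2, 11, 15, 0, 12],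
    [13, 4, 14, 1, 2, 6, 5, 3, 8, 8, 11, 15],
    [11, 12, 7, 13, 0, 9, 10, 1, 2, 4, 14, 7],
    [6, 9, 0, 8, 5, 4, 3, 10, 13, 15, 3, 14],
    [13, 15, 0, 10, 7, 3, 9, 4, 12, 6, 10, 1],
    [8, 8, 13, 15, 14, 2, 11, 4, 1, 3, 6, 5],
    [1, 2, 11, 7, 13, 10, 7, 14, 0, 12, 9, 4],
    [14, 15, 5, 11, 3, 12, 0, 8, 6, 2, 5, 9],
    [10, 3, 9, 4, 14, 15, 0, 9, 7, 5, 12, 2],
    [4, 5, 3, 6, 8, 8, 14, 15, 11, 1, 13, 2]] ! i ! j))"
  have "list_all (\<lambda>j. pairwise_balanced (columns 12 4 (\<lambda>i. F i j))) [0..<12]"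
    unfolding F_def by code_simp
  then have "strength2 12 4 (\<lambda>i. F i j)" if "j < 12" for j
    using that by (simp add: list_all_iff pairwise_balanced_imp_strength2 del: upt_rec_numeral)
  moreover have "list_all (\<lambda>i. pairwise_balanced (columns 12 4 (F i))) [0..<12]"
    unfolding F_def by code_simp
  moreover have "uniform 9 4 (cells 4 12 12 F)"
    unfolding F_def by code_simp
  ultimately have "extended_design 4 4 12 12 F"
    by (intro extended_designI) simp_all
  then show ?thesis
    by (auto simp: extensible_def)
qed

section \<open>Covering the admissible parameters\<close>

lemma le_of_power2_dvd:
  assumes "2 ^ k dvd 2 ^ e * (c :: nat)" "odd c"
  shows "k \<le> e"
proof -
  have "coprime (2 ^ k) c"
    using assms(2) by (simp add: coprime_commute)
  then have "(2::nat) ^ k dvd 2 ^ e"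
    using assms(1) by (simp add: coprime_dvd_mult_left_iff)
  then show ?thesis
    by (simp add: power_dvd_imp_le)
qed

text \<open>There are three cases: 4 columns; \<open>4 * b\<close> columns with odd
  \<open>b \<ge> 3\<close>, assembled from blocks of 12 and 8; and a multiple of 8, reached by
  \<open>extensible_power\<close>.\<close>

lemma extensible_admissible:
  assumes m: "m \<in> {1, 2, 3, 4, 5}" and b: "odd b" and "2 \<le> a"
    and k: "k + 1 \<le> 4 * m" "k + 1 \<le> 2 ^ a * b"
    and dvd: "2 ^ k dvd 4 * m * (2 ^ a * b)"
    and ex: "\<not> (k = 3 \<and> odd m \<and> 2 ^ a * b = 4)" "\<not> (k = 3 \<and> m = 1 \<and> a = 2)"
  shows "extensible k k (4 * m) (2 ^ a * b)"
proof -
  have "0 < b" using b by (rule odd_pos)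
  \<comment> \<open>The 2-adic valuation of \<open>4 * m\<close> is 2 for odd \<open>m\<close>, 3
    for \<open>m = 2\<close> and 4 for \<open>m = 4\<close>.\<close>
  have odd_m: "k \<le> a + 2" if "odd m"
    using dvd that b le_of_power2_dvd[of k "a + 2" "m * b"] by (simp add: power_add mult_ac)
  have two: "k \<le> a + 3" if "m = 2"
    using dvd that b le_of_power2_dvd[of k "a + 3" b] by (simp add: power_add mult_ac)
  have four: "k \<le> a + 4" if "m = 4"
    using dvd that b le_of_power2_dvd[of k "a + 4" b] by (simp add: power_add mult_ac)
  have 4: "extensible 2 2 4 4"
    using extensible_4_4 by (rule extensible_mono) simp
  have 48: "extensible 3 3 4 8"
    using extensible_double[OF extensible_4_4, of 1] by simp
  have 84: "extensible 3 3 8 4"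
    using 48 by (rule extensible_swap)
  have 816: "extensible 7 7 8 16"
    using extensible_double[OF extensible_8_8, of 1] by simp
  have 168: "extensible 7 7 16 8"
    using 816 by (rule extensible_swap)
  \<comment> \<open>Its transpose supplies size 16 x 12, where the valuation allows 6
    factors.\<close>
  have 1216: "extensible 6 6 12 16"
    using extensible_mono[OF extensible_double[OF extensible_12_8, of 1], of 6] by simp
  consider "a = 2" "b = 1" | "a = 2" "b \<noteq> 1" | "3 \<le> a"
    using \<open>2 \<le> a\<close> by linarith
  then show ?thesis
  proof cases
    case 1
    then have "k \<le> 3" using k(2) by simp
    then consider "k \<le> 2" | "k = 3" by linarith
    then show ?thesis
    proof cases
      case k2: 1
      have "extensible 2 2 4 (m * 4)"
        using 4 by (rule extensible_mult) (use m in auto)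
      then have "extensible 2 2 (4 * m) 4"
        using extensible_swap by (simp add: mult.commute)
      with k2 1 show ?thesis
        using extensible_mono by auto
    next
      case k3: 2
      \<comment> \<open>Odd \<open>m\<close> is excepted here; sizes 8 x 4 and 16 x 4 are transposes
        of one and two copies of 4 x 8.\<close>
      then have "m = 2 \<or> m = 4"
        using ex(1) 1 m by auto
      moreover have "extensible 3 3 16 4"
        using extensible_swap[OF extensible_append[OF 48 48]] by simp
      ultimately show ?thesis
        using k3 1 84 by auto
    qed
  next
    case 2
    then have "3 \<le> b" using b 2(2) by presburger
    \<comment> \<open>With \<open>a = 2\<close> the valuation bounds \<open>k\<close> by 4 for odd
      \<open>m\<close>, by 5 for \<open>m = 2\<close> and by 6 for \<open>m = 4\<close>; these are
      the values of \<open>l\<close> used below.\<close>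
    have step: "extensible k k (4 * m) (2 ^ a * b)"
      if "k \<le> l" "extensible l l (4 * m) 12" "extensible l l (4 * m) 8" for l
      using extensible_12_8_sum[OF that(2,3) b \<open>3 \<le> b\<close>] extensible_mono that(1) 2 by simp
    have 5: "extensible 4 4 8 12" "extensible 5 5 8 12" "extensible 4 4 12 8"
      "extensible 4 4 8 8" "extensible 5 5 8 8" "extensible 4 4 20 8"
      using extensible_mono[OF extensible_12_8, of 4] extensible_mono[OF extensible_12_8, of 5]
        extensible_mono[OF extensible_8_8, of 4] extensible_mono[OF extensible_8_8, of 5]
        extensible_mono[OF extensible_20_8, of 4] extensible_swap by simp_all
    consider "m = 1" | "m = 2" | "m = 3" | "m = 4" | "m = 5"
      using m by blast
    then show ?thesis
    proof cases
      case m: 1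
      then have "k \<le> 2"
        using k(1) ex(2) 2(1) by auto
      then show ?thesis
        using extensible_mono[OF extensible_mult[OF 4 \<open>0 < b\<close>], of k] m 2(1) by (simp add: mult.commute)
    next
      case m: 2
      show ?thesis
        by (rule step[of 5]) (use two m 2(1) 5 in auto)
    next
      case m: 3
      show ?thesis
        by (rule step[of 4]) (use odd_m m 2(1) 5 extensible_12_12 in auto)
    next
      case m: 4
      show ?thesis
        by (rule step[of 6])
          (use four m 2(1) extensible_swap[OF 1216] extensible_mono[OF 168, of 6] in auto)
    next
      case m: 5
      \<comment> \<open>The transpose of a 12 x 12 and a 12 x 8 design side by side.\<close>
      have 2012: "extensible 4 4 20 12"
        using extensible_swap[OF extensible_append[OF extensible_12_12 5(3)]] by simp
      show ?thesis
        by (rule step[of 4]) (use 2012 odd_m m 2(1) 5 in auto)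
    qed
  next
    case 3
    \<comment> \<open>The starting designs for \<open>m\<close> in 2, 3, 5, and for
      \<open>m = 4\<close> with \<open>4 \<le> a\<close>, have \<open>K = 4 * m - 1\<close>, Rao's
      bound, and \<open>l - d\<close> equal to the valuation of \<open>4 * m\<close>. For
      \<open>m = 1\<close> Rao's bound gives \<open>k \<le> 3\<close>. For \<open>m = 4\<close> and
      \<open>a = 3\<close> the 16 x 16 design can be too wide, but \<open>k \<le> 7\<close> and 16 x
      8 is enough.\<close>
    consider "m = 1" | "m = 2" | "m = 3" | "m = 4" "a = 3" | "m = 4" "4 \<le> a" | "m = 5"
      using m 3 by force
    then show ?thesis
    proof cases
      case 1
      show ?thesis
        using extensible_power[of 3 3 4 3 a k b] 48 1 3 \<open>0 < b\<close> k(1) by simp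
    next
      case 2
      show ?thesis
        using extensible_power[of 7 6 8 3 a k b] extensible_8_8 2 3 \<open>0 < b\<close> k(1) two by simp
    next
      case m: 3
      show ?thesis
        using extensible_power[of 11 5 12 3 a k b] extensible_12_8 m 3 \<open>0 < b\<close> k(1) odd_m by simp
    next
      case 4
      show ?thesis
        using extensible_power[of 7 7 16 3 a k b] 168 4 \<open>0 < b\<close> four by simp
    next
      case 5
      show ?thesis
        using extensible_power[of 15 8 16 4 a k b] extensible_16_16 5 \<open>0 < b\<close> k(1) four by simp
    next
      case 6
      show ?thesis
        using extensible_power[of 19 5 20 3 a k b] extensible_20_8 6 3 \<open>0 < b\<close> k(1) odd_m by simp
    qed
  qed
qed

lemma orthogonal_array_four_dvd:
  assumes "orthogonal_array n k 2 2 A"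
  shows "4 dvd n"
proof -
  have "2 \<le> k"
    using assms by (simp add: orthogonal_array_def)
  then have "4 * (\<Sum>i<n. of_bool ((A i 0 = 1) = True \<and> (A i 1 = 1) = True)) = n"
    by (intro orthogonal_array_pair[OF assms]) auto
  then show ?thesis
    by (rule dvdI[OF sym])
qed

theorem theorem9:
  fixes m a b k :: nat
  assumes "1 \<le> m" and "m \<le> 5"
    and "odd b"
    and "admissible (k, 4 * m, 2 ^ a * b, 2, 2)"
    and "(k, 4 * m, 2 ^ a * b, 2, 2) \<notin>
           {(3, 4 * c, 4, 2, 2) | c :: nat. odd c} \<union>
           {(3, 4, 4 * c, 2 :: nat, 2 :: nat) | c :: nat. odd c}"
  shows "\<exists>F. factorial_design k (4 * m) (2 ^ a * b) 2 2 F"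
proof -
  obtain A B where A: "orthogonal_array (4 * m) k 2 2 A"
    and B: "orthogonal_array (2 ^ a * b) k 2 2 B"
    and dvd: "2 ^ k dvd 4 * m * (2 ^ a * b)"
    using assms(4) by (auto simp: admissible_def)
  have "2 \<le> k"
    using A by (simp add: orthogonal_array_def)
  \<comment> \<open>Strength 2 forces the number of columns to be a multiple of 4, and
    \<open>b\<close> is odd.\<close>
  have "2 ^ 2 dvd 2 ^ a * b"
    using orthogonal_array_four_dvd[OF B] by simp
  then have "2 \<le> a"
    using assms(3) by (rule le_of_power2_dvd)
  have "k + 1 \<le> 4 * m" "k + 1 \<le> 2 ^ a * b"
    using orthogonal_array_imp_strength2[OF A] orthogonal_array_imp_strength2[OF B]
      strength2_rao assms(1) odd_pos[OF assms(3)] by simp_all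
  \<comment> \<open>These are the exceptional families with \<open>c = m\<close> and
    \<open>c = b\<close>.\<close>
  moreover have "\<not> (k = 3 \<and> odd m \<and> 2 ^ a * b = 4)" "\<not> (k = 3 \<and> m = 1 \<and> a = 2)"
    using assms(3,5) by auto
  moreover have "m \<in> {1, 2, 3, 4, 5}"
    using assms(1,2) by auto
  ultimately have "extensible k k (4 * m) (2 ^ a * b)"
    using assms(3) \<open>2 \<le> a\<close> dvd by (intro extensible_admissible)
  then show ?thesis
    using \<open>2 \<le> k\<close> by (rule extensible_imp_factorial_design)
qed

end
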